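(* Let $X$ be a real Banach space, let $A:X\rightarrow X^*$ be linear, continuous and ultramaximally monotone, and let $S:=\frac{A-A^*}{2}:X\to X^*$. Suppose that there exists a proper lower semicontinuous and convex function $g:X\rightarrow\,]-\infty,+\infty]$ such that $\operatorname{int}\operatorname{dom} g\neq\varnothing$ and $\partial g-S$ is of type (NI). Then $X$ is reflexive.
   Context: $X$ is a real Banach space with dual $X^*$ and bidual $X^{**}$; $X$ is identified with its canonical image in $X^{**}$, and $\langle\cdot,\cdot\rangle$ denotes the duality pairing. For a set-valued operator $T:X\rightrightarrows X^*$, $\operatorname{gra}T=\{(x,x^* )\in X\times X^*\mid x^*\in Tx\}$; single-valued operators are regarded as set-valued. $T$ is monotone if $\langle x-y,x^*-y^*\rangle\ge 0$ for all $(x,x^* ),(y,y^* )\in\operatorname{gra}T$, and maximally monotone if it is monotone and has no proper monotone extension in $X\times X^*$. A monotone $T$ is ultramaximally monotone if it is maximally monotone with respect to $X^{**}\times X^*$: whenever $(x^{**},x^* )\in X^{**}\times X^*$ satisfies $\langle x^{**}-a,x^*-a^*\rangle\ge 0$ for all $(a,a^* )\in\operatorname{gra}T$, then $x^{**}\in X$ and $(x^{**},x^* )\in\operatorname{gra}T$. Being of type (NI) means: $T$ is maximally monotone and $\inf_{(a,a^* )\in\operatorname{gra}T}\langle x^{**}-a,x^*-a^*\rangle\le 0$ for all $(x^{**},x^* )\in X^{**}\times X^*$. For $A:X\to X^*$ continuous and linear, $A^*:X^{**}\to X^*$ is its adjoint, $\langle x,A^*x^{**}\rangle=\langle x^{**},Ax\rangle$,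 which in the definition of $S$ is restricted to $X\subseteq X^{**}$. $\operatorname{dom}g=\{x\mid g(x)<+\infty\}$, $g$ is proper if $\operatorname{dom}g\ne\varnothing$, $\operatorname{int}$ is the norm interior, and $\partial g(x)=\{x^*\in X^*\mid \langle y-x,x^*\rangle+g(x)\le g(y)\ \forall y\in X\}$. $(\partial g-S)x=\{x^*-Sx\mid x^*\in\partial g(x)\}$. *)

theory Defs
  imports "HOL-Analysis.Analysis"
begin

type_synonym 'a dual = "'a \<Rightarrow>\<^sub>L real"
type_synonym 'a bidual = "'a dual dual"

lift_definition bidual_embed :: "'a::real_normed_vector \<Rightarrow> 'a bidual"
  is "\<lambda>x xs. blinfun_apply xs x"
  by (rule blinfun.bounded_linear_left)

definition reflexive_space :: "'a::real_normed_vector itself \<Rightarrow> bool" where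
  "reflexive_space _ \<longleftrightarrow> surj (bidual_embed :: 'a \<Rightarrow> 'a bidual)"

definition gra :: "('a \<Rightarrow> 'b set) \<Rightarrow> ('a \<times> 'b) set" where
  "gra T = {(x, xs). xs \<in> T x}"

definition monotone_operator :: "('a::real_normed_vector \<Rightarrow> 'a dual set) \<Rightarrow> bool" where
  "monotone_operator T \<longleftrightarrow>
    (\<forall>(x, xs)\<in>gra T. \<forall>(y, ys)\<in>gra T. blinfun_apply (xs - ys) (x - y) \<ge> 0)"

definition maximally_monotone :: "('a::real_normed_vector \<Rightarrow> 'a dual set) \<Rightarrow> bool" where
  "maximally_monotone T \<longleftrightarrow> monotone_operator T \<and>
    (\<forall>T'. monotone_operator T' \<and> gra T \<subseteq> gra T' \<longrightarrow> gra T' = gra T)"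

definition ultramaximally_monotone :: "('a::real_normed_vector \<Rightarrow> 'a dual set) \<Rightarrow> bool" where
  "ultramaximally_monotone T \<longleftrightarrow> monotone_operator T \<and>
    (\<forall>(xss :: 'a bidual) xs.
      (\<forall>(a, as)\<in>gra T. blinfun_apply (xss - bidual_embed a) (xs - as) \<ge> 0) \<longrightarrow>
      (\<exists>x. xss = bidual_embed x \<and> (x, xs) \<in> gra T))"

(* The infimum is taken in the extended reals, where it may be - \<infinity>. *)
definition type_NI :: "('a::real_normed_vector \<Rightarrow> 'a dual set) \<Rightarrow> bool" where
  "type_NI T \<longleftrightarrow> maximally_monotone T \<and>
    (\<forall>(xss :: 'a bidual) xs.
      (INF (a, as)\<in>gra T. ereal (blinfun_apply (xss - bidual_embed a) (xs - as))) \<le> 0)"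

definition bidual_adjoint :: "('a::real_normed_vector \<Rightarrow>\<^sub>L 'a dual) \<Rightarrow> 'a bidual \<Rightarrow> 'a dual" where
  "bidual_adjoint A xss = xss o\<^sub>L A"

definition skew_part :: "('a::real_normed_vector \<Rightarrow>\<^sub>L 'a dual) \<Rightarrow> 'a \<Rightarrow> 'a dual" where
  "skew_part A x = (1/2) *\<^sub>R (blinfun_apply A x - bidual_adjoint A (bidual_embed x))"

definition edom :: "('a \<Rightarrow> ereal) \<Rightarrow> 'a set" where
  "edom g = {x. g x < \<infinity>}"

definition proper_fun :: "('a \<Rightarrow> ereal) \<Rightarrow> bool" where
  "proper_fun g \<longleftrightarrow> (\<forall>x. g x \<noteq> -\<infinity>) \<and> edom g \<noteq> {}"

definition lower_semicontinuous :: "('a::topological_space \<Rightarrow> ereal) \<Rightarrow> bool" where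
  "lower_semicontinuous g \<longleftrightarrow> (\<forall>x. g x \<le> Liminf (at x) g)"

(* The weights are restricted to the open interval because 0 * \<infinity> = 0 in ereal;
   intended for functions that do not take the value - \<infinity>. *)
definition convex_efun :: "('a::real_vector \<Rightarrow> ereal) \<Rightarrow> bool" where
  "convex_efun g \<longleftrightarrow> (\<forall>x y t. 0 < t \<and> t < 1 \<longrightarrow>
    g ((1 - t) *\<^sub>R x + t *\<^sub>R y) \<le> ereal (1 - t) * g x + ereal t * g y)"

definition subdifferential :: "('a::real_normed_vector \<Rightarrow> ereal) \<Rightarrow> 'a \<Rightarrow> 'a dual set" where
  "subdifferential g x = {xs. \<forall>y. ereal (blinfun_apply xs (y - x)) + g x \<le> g y}"

end

theory Submission
  imports Defs
begin

text \<open>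
  Write \<open>A = P + S\<close> with \<open>P\<close> symmetric and \<open>S\<close> skew. For \<open>x\<^sup>*\<^sup>* \<in> X\<^sup>*\<^sup>*\<close> and
  \<open>x\<^sup>* = P\<^sup>*x\<^sup>*\<^sup>* - S\<^sup>*x\<^sup>*\<^sup>*\<close> one computes
  \<open>\<langle>x\<^sup>*\<^sup>* - a, x\<^sup>* - Aa\<rangle> = \<langle>x\<^sup>*\<^sup>* - a, P\<^sup>*(x\<^sup>*\<^sup>* - a)\<rangle> - \<langle>x\<^sup>*\<^sup>*, S\<^sup>*x\<^sup>*\<^sup>*\<rangle>\<close>, and \<open>P\<^sup>*\<close> is monotone on the
  bidual, so ultramaximality puts \<open>x\<^sup>*\<^sup>*\<close> into \<open>X\<close> as soon as \<open>\<langle>x\<^sup>*\<^sup>*, S\<^sup>*x\<^sup>*\<^sup>*\<rangle> \<le> 0\<close>.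

  This last inequality is what type (NI) of \<open>\<partial>g - S\<close> gives. By homogeneity and since
  \<open>\<langle>x\<^sup>*\<^sup>*, S\<^sup>*x\<^sup>*\<^sup>*\<rangle>\<close> is unchanged when an element of \<open>X\<close> is added to \<open>x\<^sup>*\<^sup>*\<close>, one may assume that
  \<open>x\<^sup>*\<^sup>*\<close> is close to a point around which \<open>g\<close> is bounded above. Then \<open>g\<^sup>*\<^sup>*(x\<^sup>*\<^sup>*)\<close> is finite, and
  for a \<open>z\<^sup>*\<close> that almost attains the supremum \<open>g\<^sup>*\<^sup>*(x\<^sup>*\<^sup>*) = sup (\<langle>x\<^sup>*\<^sup>*, z\<^sup>*\<rangle> - g\<^sup>*(z\<^sup>*))\<close> the pair
  \<open>(x\<^sup>*\<^sup>*, z\<^sup>*)\<close> is almost monotonically related to \<open>gra \<partial>g\<close>. Testing (NI) at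
  \<open>(x\<^sup>*\<^sup>*, S\<^sup>*x\<^sup>*\<^sup>* + z\<^sup>*)\<close> yields the claim.
\<close>

section \<open>Canonical embedding and skew part\<close>

lemma bidual_embed_apply [simp]: "blinfun_apply (bidual_embed x) f = blinfun_apply f x"
  by transfer simp

lemma norm_bidual_embed_le: "norm (bidual_embed (x::'a::real_normed_vector)) \<le> norm x"
proof (rule norm_blinfun_bound)
  fix f :: "'a dual"
  show "norm (blinfun_apply (bidual_embed x) f) \<le> norm x * norm f"
    using norm_blinfun[of f x] by (simp add: mult.commute)
qed simp

lemma bounded_linear_bidual_embed: "bounded_linear bidual_embed"
  by (rule bounded_linear_intro[where K = 1])
    (auto intro!: blinfun_eqI norm_bidual_embed_le simp: blinfun.bilinear_simps)

lemma bounded_linear_skew_part: "bounded_linear (skew_part A)"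
proof -
  have "bounded_linear (\<lambda>x. bidual_embed x o\<^sub>L A)"
    by (intro bounded_linear_compose[OF
        bounded_bilinear.bounded_linear_left[OF bounded_bilinear_blinfun_compose]
        bounded_linear_bidual_embed])
  then show ?thesis
    unfolding skew_part_def bidual_adjoint_def
    by (intro bounded_linear_scaleR_right[THEN bounded_linear_compose] bounded_linear_sub
        blinfun.bounded_linear_right)
qed

lemma skew_part_apply:
  "blinfun_apply (skew_part A x) y =
     (blinfun_apply (blinfun_apply A x) y - blinfun_apply (blinfun_apply A y) x) / 2"
  by (simp add: skew_part_def bidual_adjoint_def blinfun.bilinear_simps)

section \<open>Positive semidefinite symmetric forms and their extension to the bidual\<close>

lemma quadratic_nonneg_imp_discriminant:
  fixes a b c :: real
  assumes "\<And>t. 0 \<le> a + 2 * t * b + t\<^sup>2 * c" and "0 \<le> c"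
  shows "b\<^sup>2 \<le> a * c"
proof (cases "c = 0")
  case True
  have "b = 0"
  proof (rule ccontr)
    assume "b \<noteq> 0"
    \<comment> \<open>With \<open>c = 0\<close> the expression is affine in \<open>t\<close>; the
      chosen \<open>t\<close> gives it the value -1.\<close>
    then show False
      using assms(1)[of "- (a + 1) / (2 * b)"] True by (simp add: field_simps)
  qed
  then show ?thesis
    using True by simp
next
  case False
  with assms(2) have "c > 0"
    by simp
  then show ?thesis
    using assms(1)[of "- b / c"] by (simp add: field_simps power2_eq_square)
qed

context
  fixes P :: "'a::real_normed_vector \<Rightarrow>\<^sub>L 'a dual"
  assumes sym: "\<And>x y. blinfun_apply (blinfun_apply P x) y = blinfun_apply (blinfun_apply P y) x"
    and nonneg: "\<And>x. 0 \<le> blinfun_apply (blinfun_apply P x) x"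
begin

lemma symmetric_form_le: "blinfun_apply (blinfun_apply P b) b \<le> norm P * (norm b)\<^sup>2"
proof -
  have "blinfun_apply (blinfun_apply P b) b \<le> norm (blinfun_apply P b) * norm b"
    using norm_blinfun[of "blinfun_apply P b" b] by simp
  also have "\<dots> \<le> norm P * norm b * norm b"
    by (intro mult_right_mono norm_blinfun) auto
  finally show ?thesis
    by (simp add: power2_eq_square)
qed

lemma norm_le_sqrt_form:
  assumes "\<And>b. (blinfun_apply f b)\<^sup>2 \<le> e * blinfun_apply (blinfun_apply P b) b" and "0 \<le> e"
  shows "norm f \<le> sqrt (e * norm P)"
proof (rule norm_blinfun_bound)
  fix b
  have "(blinfun_apply f b)\<^sup>2 \<le> e * (norm P * (norm b)\<^sup>2)"
    using assms(1)[of b] mult_left_mono[OF symmetric_form_le assms(2), of b] by linarith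
  then have "\<bar>blinfun_apply f b\<bar> \<le> sqrt (e * (norm P * (norm b)\<^sup>2))"
    using real_le_rsqrt[of "\<bar>blinfun_apply f b\<bar>"] by simp
  then show "norm (blinfun_apply f b) \<le> sqrt (e * norm P) * norm b"
    by (simp add: real_sqrt_mult mult.assoc)
qed (use assms(2) in auto)

lemma form_expand:
  "blinfun_apply (blinfun_apply P (a + t *\<^sub>R b)) (a + t *\<^sub>R b) =
     blinfun_apply (blinfun_apply P a) a + 2 * t * blinfun_apply (blinfun_apply P a) b
       + t\<^sup>2 * blinfun_apply (blinfun_apply P b) b"
  using sym[of a b] by (simp add: blinfun.bilinear_simps algebra_simps power2_eq_square)

text \<open>Cauchy-Schwarz for the semidefinite form of \<open>P\<close>, since that form is
  nonnegative along every line through \<open>a\<close>.\<close>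

lemma norm_symmetric_le:
  "norm (blinfun_apply P a) \<le> sqrt (blinfun_apply (blinfun_apply P a) a * norm P)"
proof (rule norm_le_sqrt_form)
  fix b
  show "(blinfun_apply (blinfun_apply P a) b)\<^sup>2
      \<le> blinfun_apply (blinfun_apply P a) a * blinfun_apply (blinfun_apply P b) b"
  proof (rule quadratic_nonneg_imp_discriminant)
    fix t
    show "0 \<le> blinfun_apply (blinfun_apply P a) a + 2 * t * blinfun_apply (blinfun_apply P a) b
        + t\<^sup>2 * blinfun_apply (blinfun_apply P b) b"
      using nonneg[of "a + t *\<^sub>R b"] by (simp only: form_expand)
  qed (rule nonneg)
qed (rule nonneg)

text \<open>
  The functional \<open>y = P\<^sup>*w\<close> is bounded for the seminorm of \<open>P\<close>; an almost-maximizer \<open>a\<close> of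
  \<open>2 \<langle>a, y\<rangle> - \<langle>a, Pa\<rangle>\<close> replaces its Riesz representative, so that \<open>Pa\<close> is close to \<open>y\<close> in norm.
\<close>

lemma symmetric_adjoint_nonneg: "0 \<le> blinfun_apply w (w o\<^sub>L P)"
proof -
  define y where "y = w o\<^sub>L P"
  define F where "F a = 2 * blinfun_apply y a - blinfun_apply (blinfun_apply P a) a" for a
  have y: "blinfun_apply y a = blinfun_apply w (blinfun_apply P a)" for a
    by (simp add: y_def)
  have "F a \<le> (norm w)\<^sup>2 * norm P" for a
  proof -
    define s where "s = sqrt (blinfun_apply (blinfun_apply P a) a)"
    have "blinfun_apply y a \<le> norm w * norm (blinfun_apply P a)"
      using norm_blinfun[of w "blinfun_apply P a"] by (simp add: y)
    also have "\<dots> \<le> norm w * (s * sqrt (norm P))"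
      using norm_symmetric_le[of a] by (intro mult_left_mono) (auto simp: s_def real_sqrt_mult)
    finally have "blinfun_apply y a \<le> s * (norm w * sqrt (norm P))"
      by (simp add: algebra_simps)
    \<comment> \<open>The part of \<open>F\<close> linear in \<open>s\<close> is absorbed by the
      term -s^2 coming from the form.\<close>
    moreover have "2 * (s * (norm w * sqrt (norm P))) \<le> s\<^sup>2 + (norm w * sqrt (norm P))\<^sup>2"
      using sum_squares_bound[of s "norm w * sqrt (norm P)"] by simp
    moreover have "s\<^sup>2 = blinfun_apply (blinfun_apply P a) a"
      using nonneg by (simp add: s_def)
    ultimately show ?thesis
      by (simp add: F_def power_mult_distrib)
  qed
  then have bdd: "bdd_above (range F)"
    by (auto intro!: bdd_aboveI)
  have F_le: "F a \<le> Sup (range F)" for a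
    using bdd by (auto intro: cSup_upper)
  have Sup_nonneg: "0 \<le> Sup (range F)"
    using F_le[of 0] by (simp add: F_def blinfun.bilinear_simps)
  \<comment> \<open>Slack \<open>d\<^sup>2\<close> in the supremum becomes an error of order
    \<open>d\<close> in the norm of \<open>y - P a\<close>.\<close>
  have approx: "- (d\<^sup>2 / 2 + norm w * (d * sqrt (norm P))) \<le> blinfun_apply w y" if "d > 0" for d
  proof -
    have "Sup (range F) - d\<^sup>2 < Sup (range F)"
      using that by simp
    then obtain a where a: "Sup (range F) - d\<^sup>2 < F a"
      using less_cSup_iff[OF _ bdd] by blast
    have "norm (y - blinfun_apply P a) \<le> sqrt (d\<^sup>2 * norm P)"
    proof (rule norm_le_sqrt_form)
      fix b
      have "(- blinfun_apply (y - blinfun_apply P a) b)\<^sup>2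
          \<le> d\<^sup>2 * blinfun_apply (blinfun_apply P b) b"
      proof (rule quadratic_nonneg_imp_discriminant)
        fix t
        \<comment> \<open>Near-maximality on the line through \<open>a\<close> in direction
          \<open>b\<close> bounds the slope of \<open>F\<close> there, which is 2 (y - P a)
          b.\<close>
        have "F (a + t *\<^sub>R b) < F a + d\<^sup>2"
          using a F_le[of "a + t *\<^sub>R b"] by linarith
        then show "0 \<le> d\<^sup>2 + 2 * t * - blinfun_apply (y - blinfun_apply P a) b
            + t\<^sup>2 * blinfun_apply (blinfun_apply P b) b"
          unfolding F_def form_expand by (simp add: blinfun.bilinear_simps algebra_simps)
      qed (rule nonneg)
      then show "(blinfun_apply (y - blinfun_apply P a) b)\<^sup>2
          \<le> d\<^sup>2 * blinfun_apply (blinfun_apply P b) b"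
        by simp
    qed simp
    then have "norm (y - blinfun_apply P a) \<le> d * sqrt (norm P)"
      using that by (simp add: real_sqrt_mult)
    then have "norm w * norm (y - blinfun_apply P a) \<le> norm w * (d * sqrt (norm P))"
      by (rule mult_left_mono) simp
    then have "- (norm w * (d * sqrt (norm P))) \<le> blinfun_apply w (y - blinfun_apply P a)"
      using norm_blinfun[of w "y - blinfun_apply P a"] by simp
    moreover have "blinfun_apply w (y - blinfun_apply P a) = blinfun_apply w y - blinfun_apply y a"
      by (simp add: y blinfun.bilinear_simps)
    moreover have "- (d\<^sup>2 / 2) \<le> blinfun_apply y a"
      using a Sup_nonneg nonneg[of a] by (simp add: F_def)
    ultimately show ?thesis
      by linarith
  qed
  have "((\<lambda>d. - (d\<^sup>2 / 2 + norm w * (d * sqrt (norm P)))) \<longlongrightarrow>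
      - (0\<^sup>2 / 2 + norm w * (0 * sqrt (norm P)))) (at_right 0)"
    by (intro tendsto_intros) auto
  then have "((\<lambda>d. - (d\<^sup>2 / 2 + norm w * (d * sqrt (norm P)))) \<longlongrightarrow> 0) (at_right 0)"
    by simp
  then have "0 \<le> blinfun_apply w y"
    by (rule tendsto_upperbound[OF _ eventually_mono[OF eventually_at_right_less approx]]) simp_all
  then show ?thesis
    by (simp add: y_def)
qed

end

section \<open>Local boundedness of \<open>g\<close> and its biconjugate\<close>

lemma closed_sublevel:
  assumes "lower_semicontinuous g"
  shows "closed {x. g x \<le> c}"
proof -
  have "\<forall>\<^sub>F y in nhds x. c < g y" if "c < g x" for x
  proof -
    have "c < Liminf (at x) g"
      using that assms unfolding lower_semicontinuous_def by (metis less_le_trans)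
    then have "\<forall>\<^sub>F y in at x. c < g y"
      by (rule less_LiminfD)
    then show ?thesis
      using that by (simp add: eventually_nhds_conv_at)
  qed
  then have "\<exists>U. open U \<and> x \<in> U \<and> (\<forall>y\<in>U. c < g y)" if "c < g x" for x
    using that by (simp add: eventually_nhds)
  then have "open {x. c < g x}"
    by (subst open_subopen) (simp add: subset_iff Ball_def)
  moreover have "{x. g x \<le> c} = - {x. c < g x}"
    by auto
  ultimately show ?thesis
    by (metis closed_Compl)
qed

text \<open>Baire category: countably many closed sublevel sets cover \<open>edom g\<close>, so one
  of them has interior points.\<close>

lemma lower_semicontinuous_locally_bounded:
  fixes g :: "'a::banach \<Rightarrow> ereal"
  assumes "lower_semicontinuous g" and "interior (edom g) \<noteq> {}"
  obtains x0 r M where "0 < r" and "\<And>x. x \<in> cball x0 r \<Longrightarrow> g x \<le> ereal M"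
proof -
  define C where "C n = {x. g x \<le> ereal (real n)}" for n
  have "\<exists>n. interior (C n) \<noteq> {}"
  proof (rule ccontr)
    assume "\<nexists>n. interior (C n) \<noteq> {}"
    moreover have "closed (C n)" for n
      unfolding C_def using assms(1) by (rule closed_sublevel)
    ultimately have "euclidean interior_of \<Union>(range C) = {}"
      by (intro Baire_category_alt) (auto simp: completely_metrizable_space_euclidean)
    moreover have "edom g \<subseteq> \<Union>(range C)"
    proof
      fix x assume "x \<in> edom g"
      then have "g x \<noteq> \<infinity>"
        by (simp add: edom_def)
      then obtain n :: nat where "g x \<le> ereal (real n)"
        using real_arch_simple by (cases "g x") auto
      then show "x \<in> \<Union>(range C)"
        by (auto simp: C_def)
    qed
    ultimately show False
      using assms(2) interior_mono[of "edom g" "\<Union>(range C)"] by simp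
  qed
  then obtain n x0 where "x0 \<in> interior (C n)"
    by blast
  then obtain r where "r > 0" "cball x0 r \<subseteq> C n"
    by (auto simp: mem_interior_cball)
  then show thesis
    by (intro that[of r x0 "real n"]) (auto simp: C_def)
qed

lemma bidual_almost_monotonically_related:
  fixes g :: "'a::real_normed_vector \<Rightarrow> ereal" and w :: "'a bidual"
  assumes proper: "proper_fun g"
    and bound: "\<And>x. x \<in> cball x0 r \<Longrightarrow> g x \<le> ereal M"
    and near: "norm (w - bidual_embed x0) \<le> r"
    and "0 < e"
    and ne: "gra (subdifferential g) \<noteq> {}"
  obtains z where "\<And>a as. as \<in> subdifferential g a \<Longrightarrow>
    - e < blinfun_apply (w - bidual_embed a) (z - as)"
proof -
  \<comment> \<open>\<open>D\<close> is the epigraph of the conjugate of \<open>g\<close>: its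
    members are the continuous affine minorants of \<open>g\<close>.\<close>
  define D where "D = {(z, k). \<forall>x. ereal (blinfun_apply z x - k) \<le> g x}"
  define V where "V = (\<lambda>(z, k). blinfun_apply w z - k) ` D"
  have r: "0 \<le> r"
    using near norm_ge_zero order_trans by blast
  have V_le: "blinfun_apply w z - k \<le> M" if "(z, k) \<in> D" for z k
  proof -
    have le: "blinfun_apply z x - k \<le> M" if "x \<in> cball x0 r" for x
    proof -
      have "ereal (blinfun_apply z x - k) \<le> g x"
        using \<open>(z, k) \<in> D\<close> by (simp add: D_def)
      also note bound[OF that]
      finally have "ereal (blinfun_apply z x - k) \<le> ereal M" .
      then show ?thesis
        by simp
    qed
    \<comment> \<open>The supremum of \<open>z\<close> over the ball is
      \<open>z x0 + r * norm z\<close>.\<close>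
    have norm_z: "r * norm z \<le> M + k - blinfun_apply z x0"
    proof (cases "r = 0")
      case True
      then show ?thesis
        using le[of x0] by simp
    next
      case False
      then have "r > 0"
        using r by simp
      have "norm z \<le> (M + k - blinfun_apply z x0) / r"
      proof (rule norm_blinfun_bound)
        show "0 \<le> (M + k - blinfun_apply z x0) / r"
          using le[of x0] r by simp
        fix v
        show "norm (blinfun_apply z v) \<le> (M + k - blinfun_apply z x0) / r * norm v"
        proof (cases "v = 0")
          case True
          then show ?thesis
            by (simp add: blinfun.bilinear_simps)
        next
          case False
          have "blinfun_apply z (x0 + (s * r / norm v) *\<^sub>R v) - k \<le> M" if "\<bar>s\<bar> = 1" for s
            using that False r by (intro le) (simp add: dist_norm abs_mult)
          from this[of 1] this[of "-1"]
          have "r / norm v * \<bar>blinfun_apply z v\<bar> \<le> M + k - blinfun_apply z x0"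
            by (auto simp: blinfun.bilinear_simps abs_if)
          then show ?thesis
            using False \<open>r > 0\<close> by (simp add: field_simps)
        qed
      qed
      then show ?thesis
        using \<open>r > 0\<close> by (simp add: field_simps)
    qed
    have "blinfun_apply (w - bidual_embed x0) z \<le> norm (w - bidual_embed x0) * norm z"
      using norm_blinfun[of "w - bidual_embed x0" z] by simp
    also have "\<dots> \<le> r * norm z"
      using near by (rule mult_right_mono) simp
    finally show ?thesis
      using norm_z by (simp add: blinfun.bilinear_simps)
  qed
  \<comment> \<open>A subgradient at \<open>a\<close> yields a minorant exact at \<open>a\<close>
    (equality in Fenchel-Young).\<close>
  have D_sub: "\<exists>k. (as, k) \<in> D \<and> g a = ereal (blinfun_apply as a - k)"
    if "as \<in> subdifferential g a" for a as
  proof -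
    have sub: "ereal (blinfun_apply as (x - a)) + g a \<le> g x" for x
      using that by (simp add: subdifferential_def)
    from proper obtain b where "g b < \<infinity>"
      by (auto simp: proper_fun_def edom_def)
    then have "g a \<noteq> \<infinity>"
      using sub[of b] by auto
    then obtain ga where ga: "g a = ereal ga"
      using proper by (cases "g a") (auto simp: proper_fun_def)
    have "(as, blinfun_apply as a - ga) \<in> D"
      using sub ga by (auto simp: D_def blinfun.bilinear_simps algebra_simps)
    then show ?thesis
      using ga by auto
  qed
  \<comment> \<open>\<open>G = g\<^sup>*\<^sup>*(w)\<close>\<close>
  define G where "G = Sup V"
  have bdd: "bdd_above V"
    using V_le by (auto simp: V_def intro!: bdd_aboveI)
  have "V \<noteq> {}"
    using ne D_sub by (fastforce simp: V_def gra_def)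
  then obtain z k where zk: "(z, k) \<in> D" "G - e < blinfun_apply w z - k"
    using less_cSup_iff[of V "G - e"] bdd \<open>0 < e\<close> by (auto simp: G_def V_def)
  show thesis
  proof
    fix a as assume "as \<in> subdifferential g a"
    then obtain l where l: "(as, l) \<in> D" "g a = ereal (blinfun_apply as a - l)"
      using D_sub by blast
    have "blinfun_apply w as - l \<le> G"
      unfolding G_def using l(1) bdd by (auto simp: V_def intro!: cSup_upper)
    \<comment> \<open>Adding both bounds to the choice of \<open>z\<close> and exactness at
      \<open>a\<close> cancels \<open>G\<close>, \<open>k\<close>, \<open>l\<close> and
      \<open>g a\<close>; only -e remains.\<close>
    moreover have "ereal (blinfun_apply z a - k) \<le> g a"
      using zk(1) by (auto simp: D_def)
    ultimately show "- e < blinfun_apply (w - bidual_embed a) (z - as)"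
      using zk(2) l(2) by (simp add: blinfun.bilinear_simps)
  qed
qed

section \<open>Type (NI) and reflexivity\<close>

lemma type_NI_imp_skew_adjoint_nonpos:
  fixes g :: "'a::banach \<Rightarrow> ereal" and S :: "'a \<Rightarrow>\<^sub>L 'a dual"
  assumes "proper_fun g" "lower_semicontinuous g" "interior (edom g) \<noteq> {}"
    and NI: "type_NI (\<lambda>x. {xs - blinfun_apply S x | xs. xs \<in> subdifferential g x})"
      (is "type_NI ?T")
    and skew: "\<And>x y. blinfun_apply (blinfun_apply S x) y = - blinfun_apply (blinfun_apply S y) x"
  shows "blinfun_apply w (w o\<^sub>L S) \<le> 0"
proof -
  from assms(2,3) obtain x0 r M where r: "0 < r"
    and bound: "\<And>x. x \<in> cball x0 r \<Longrightarrow> g x \<le> ereal M"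
    by (rule lower_semicontinuous_locally_bounded) blast
  have inf_le: "(INF (a, as)\<in>gra ?T. ereal (blinfun_apply (v - bidual_embed a) (xs - as))) \<le> 0"
    for v xs
    using NI by (simp add: type_NI_def)
  \<comment> \<open>An infimum over the empty set would be \<infinity>.\<close>
  have "gra ?T \<noteq> {}"
    using inf_le[of undefined undefined] by (auto simp: top_ereal_def)
  then have ne: "gra (subdifferential g) \<noteq> {}"
    by (auto simp: gra_def)
  have nonpos: "blinfun_apply v (v o\<^sub>L S) \<le> 0" if near: "norm (v - bidual_embed x0) \<le> r" for v
  proof (rule field_le_epsilon)
    fix e :: real assume "0 < e"
    then have "0 < e / 2"
      by simp
    from bidual_almost_monotonically_related[OF assms(1) bound near this ne]
    obtain z where z: "\<And>a as. as \<in> subdifferential g a \<Longrightarrow>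
        - (e / 2) < blinfun_apply (v - bidual_embed a) (z - as)"
      by blast
    have "(INF (a, as)\<in>gra ?T.
        ereal (blinfun_apply (v - bidual_embed a) ((v o\<^sub>L S) + z - as))) < ereal (e / 2)"
      using inf_le[of v "(v o\<^sub>L S) + z"] \<open>0 < e / 2\<close> by (simp add: le_less_trans)
    then obtain a as where as: "as \<in> subdifferential g a"
      and "blinfun_apply (v - bidual_embed a) ((v o\<^sub>L S) + z - (as - blinfun_apply S a)) < e / 2"
      by (auto simp: INF_less_iff gra_def)
    \<comment> \<open>The terms \<open>v (S a)\<close> cancel, and \<open>S a\<close> vanishes at
      \<open>a\<close>.\<close>
    moreover have "blinfun_apply (v - bidual_embed a) ((v o\<^sub>L S) + z - (as - blinfun_apply S a))
        = blinfun_apply v (v o\<^sub>L S) + blinfun_apply (v - bidual_embed a) (z - as)"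
      using skew[of a a] by (simp add: blinfun.bilinear_simps)
    ultimately show "blinfun_apply v (v o\<^sub>L S) \<le> 0 + e"
      using z[OF as] by simp
  qed
  \<comment> \<open>The scaling brings \<open>v\<close> within \<open>r\<close> of
    \<open>x0\<close>; the +1 covers \<open>w = 0\<close>.\<close>
  define t where "t = r / (norm w + 1)"
  define v where "v = bidual_embed x0 + t *\<^sub>R w"
  have "t > 0"
    using r by (simp add: t_def add_nonneg_pos)
  have "t * norm w \<le> r"
    using r by (simp add: t_def divide_simps add_nonneg_pos)
  then have "blinfun_apply v (v o\<^sub>L S) \<le> 0"
    using \<open>t > 0\<close> by (intro nonpos) (simp add: v_def)
  \<comment> \<open>The adjoint of \<open>S\<close> extends \<open>- S\<close>, so the cross terms
    between \<open>x0\<close> and \<open>w\<close> cancel.\<close>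
  moreover have "bidual_embed x0 o\<^sub>L S = - blinfun_apply S x0"
    by (rule blinfun_eqI) (simp add: blinfun.bilinear_simps skew[of _ x0])
  then have "blinfun_apply v (v o\<^sub>L S) = t\<^sup>2 * blinfun_apply w (w o\<^sub>L S)"
    using skew[of x0 x0]
    by (simp add: v_def blinfun.bilinear_simps power2_eq_square algebra_simps
        bounded_bilinear.add_left[OF bounded_bilinear_blinfun_compose]
        bounded_bilinear.scaleR_left[OF bounded_bilinear_blinfun_compose])
  ultimately show ?thesis
    using \<open>t > 0\<close> by (simp add: mult_le_0_iff)
qed

theorem proposition3p17:
  fixes A :: "'a::banach \<Rightarrow>\<^sub>L 'a dual"
  assumes "ultramaximally_monotone (\<lambda>x. {blinfun_apply A x})"
    and "\<exists>g :: 'a \<Rightarrow> ereal. proper_fun g \<and> lower_semicontinuous g \<and> convex_efun g \<and>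
           interior (edom g) \<noteq> {} \<and>
           type_NI (\<lambda>x. {xs - skew_part A x | xs. xs \<in> subdifferential g x})"
  shows "reflexive_space TYPE('a)"
proof -
  define S where "S = Blinfun (skew_part A)"
  define P where "P = A - S"
  have S_apply: "blinfun_apply S = skew_part A"
    unfolding S_def by (rule bounded_linear_Blinfun_apply[OF bounded_linear_skew_part])
  have S_skew: "blinfun_apply (blinfun_apply S x) y = - blinfun_apply (blinfun_apply S y) x" for x y
    by (simp add: S_apply skew_part_apply field_simps)
  have A_eq: "blinfun_apply A x = blinfun_apply P x + blinfun_apply S x" for x
    by (simp add: P_def blinfun.bilinear_simps)
  have P_sym: "blinfun_apply (blinfun_apply P x) y = blinfun_apply (blinfun_apply P y) x" for x y
    by (simp add: P_def S_apply skew_part_apply blinfun.bilinear_simps field_simps)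
  have S_diag: "blinfun_apply (blinfun_apply S x) x = 0" for x
    using S_skew[of x x] by simp
  have P_nonneg: "0 \<le> blinfun_apply (blinfun_apply P x) x" for x
  proof -
    have "0 \<le> blinfun_apply (blinfun_apply A a - blinfun_apply A b) (a - b)" for a b
      using assms(1) by (simp add: ultramaximally_monotone_def monotone_operator_def gra_def)
    from this[of x 0] show ?thesis
      by (simp add: A_eq S_diag blinfun.bilinear_simps)
  qed
  have S_nonpos: "blinfun_apply w (w o\<^sub>L S) \<le> 0" for w
    using assms(2) type_NI_imp_skew_adjoint_nonpos[OF _ _ _ _ S_skew]
    by (auto simp: S_apply)
  have "\<exists>x. w = bidual_embed x" for w :: "'a bidual"
  proof -
    have "0 \<le> blinfun_apply (w - bidual_embed a) ((w o\<^sub>L P) - (w o\<^sub>L S) - blinfun_apply A a)" for a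
    proof -
      have "blinfun_apply (w - bidual_embed a) ((w o\<^sub>L P) - (w o\<^sub>L S) - blinfun_apply A a)
          = blinfun_apply (w - bidual_embed a) ((w o\<^sub>L P) - blinfun_apply P a)
            - blinfun_apply w (w o\<^sub>L S)"
        by (simp add: A_eq S_diag blinfun.bilinear_simps)
      \<comment> \<open>Symmetry means that the adjoint of \<open>P\<close> extends
        \<open>P\<close>, which makes the first term a value of the extended form.\<close>
      moreover have "bidual_embed a o\<^sub>L P = blinfun_apply P a"
        by (rule blinfun_eqI) (simp add: P_sym[of _ a])
      then have "(w o\<^sub>L P) - blinfun_apply P a = (w - bidual_embed a) o\<^sub>L P"
        by (simp add: bounded_bilinear.diff_left[OF bounded_bilinear_blinfun_compose])
      ultimately show ?thesis
        using S_nonpos[of w] symmetric_adjoint_nonneg[OF P_sym P_nonneg, of "w - bidual_embed a"]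
        by simp
    qed
    then have "\<forall>(a, as)\<in>gra (\<lambda>x. {blinfun_apply A x}).
        0 \<le> blinfun_apply (w - bidual_embed a) ((w o\<^sub>L P) - (w o\<^sub>L S) - as)"
      by (auto simp: gra_def)
    then show ?thesis
      using assms(1) unfolding ultramaximally_monotone_def by blast
  qed
  then show ?thesis
    unfolding reflexive_space_def surj_def by blast
qed

end
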